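(* Let $d\ge 1$ and let $P$ be a $d$-dimensional convex polytope in $\mathbb{R}^d$, with graph $G(P)$. Then $G(P)$ is $d$-connected. Moreover, if $d\ge 3$ and $X$ is a separator of $G(P)$ with exactly $d$ vertices, then for every $x\in X$: every vertex of $X\setminus\{x\}$ lies in the link $\mathrm{lk}(x)$ of $x$ in $P$, and the set $X\setminus\{x\}$ is a separator of the graph of $\mathrm{lk}(x)$.
   Context: A $d$-polytope is the convex hull of a finite set of points in $\mathbb{R}^d$ having dimension $d$. A face of $P$ is $P$ itself or the intersection of $P$ with a hyperplane such that $P$ lies in one of its closed halfspaces; faces of dimension $0$, $1$, $d-1$ are vertices, edges, facets. The graph $G(P)$ has as vertices the vertices of $P$ and as edges the edges of $P$. A graph with at least $d+1$ vertices is $d$-connected if removing any $d-1$ vertices leaves a connected graph. A set $X$ of vertices of a graph $G$ separates two vertices $u,v\notin X$ if every $u$–$v$ path in $G$ contains a vertex of $X$; $X$ is a separator of $G$ if it separates some two vertices of $G$. The link $\mathrm{lk}(x)$ of a vertex $x$ of $P$ is the set of faces of $P$ that do not contain $x$ but lie in some facet of $P$ containing $x$; its graph is the graph whose vertices are the vertices (0-dimensional faces) in $\mathrm{lk}(x)$ and whose edges are the edges (1-dimensional faces) in $\mathrm{lk}(x)$. *)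

theory Defs
  imports "HOL-Analysis.Analysis"
begin

definition reach_in :: "'v set \<Rightarrow> ('v \<Rightarrow> 'v \<Rightarrow> bool) \<Rightarrow> 'v \<Rightarrow> 'v \<Rightarrow> bool" where
  "reach_in S E u v \<longleftrightarrow> u \<in> S \<and> v \<in> S \<and> (\<lambda>a b. a \<in> S \<and> b \<in> S \<and> E a b)\<^sup>*\<^sup>* u v"

definition graph_connected :: "'v set \<Rightarrow> ('v \<Rightarrow> 'v \<Rightarrow> bool) \<Rightarrow> bool" where
  "graph_connected S E \<longleftrightarrow> (\<forall>u\<in>S. \<forall>v\<in>S. reach_in S E u v)"

definition k_connected :: "nat \<Rightarrow> 'v set \<Rightarrow> ('v \<Rightarrow> 'v \<Rightarrow> bool) \<Rightarrow> bool" where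
  "k_connected k V E \<longleftrightarrow> finite V \<and> card V \<ge> k + 1 \<and>
     (\<forall>Y. Y \<subseteq> V \<and> card Y < k \<longrightarrow> graph_connected (V - Y) E)"

definition separates :: "'v set \<Rightarrow> ('v \<Rightarrow> 'v \<Rightarrow> bool) \<Rightarrow> 'v set \<Rightarrow> 'v \<Rightarrow> 'v \<Rightarrow> bool" where
  "separates V E X u v \<longleftrightarrow> u \<in> V - X \<and> v \<in> V - X \<and> \<not> reach_in (V - X) E u v"

definition separator :: "'v set \<Rightarrow> ('v \<Rightarrow> 'v \<Rightarrow> bool) \<Rightarrow> 'v set \<Rightarrow> bool" where
  "separator V E X \<longleftrightarrow> X \<subseteq> V \<and> (\<exists>u v. separates V E X u v)"

definition poly_verts :: "'a::euclidean_space set \<Rightarrow> 'a set" where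
  "poly_verts P = {v. {v} face_of P}"

definition poly_adj :: "'a::euclidean_space set \<Rightarrow> 'a \<Rightarrow> 'a \<Rightarrow> bool" where
  "poly_adj P u v \<longleftrightarrow> u \<in> poly_verts P \<and> v \<in> poly_verts P \<and> u \<noteq> v \<and>
     (convex hull {u, v}) edge_of P"

definition link_faces :: "'a::euclidean_space set \<Rightarrow> 'a \<Rightarrow> 'a set set" where
  "link_faces P x = {F. F face_of P \<and> x \<notin> F \<and> (\<exists>G. G facet_of P \<and> x \<in> G \<and> F \<subseteq> G)}"

definition link_verts :: "'a::euclidean_space set \<Rightarrow> 'a \<Rightarrow> 'a set" where
  "link_verts P x = {v. {v} \<in> link_faces P x}"

definition link_adj :: "'a::euclidean_space set \<Rightarrow> 'a \<Rightarrow> 'a \<Rightarrow> 'a \<Rightarrow> bool" where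
  "link_adj P x u v \<longleftrightarrow> u \<in> link_verts P x \<and> v \<in> link_verts P x \<and> u \<noteq> v \<and>
     (convex hull {u, v}) edge_of P \<and> (convex hull {u, v}) \<in> link_faces P x"

end

theory Submission
  imports Defs
begin

text \<open>Every vertex of a polytope that does not maximize a linear functional has a neighbour with a
  larger value; hence the vertices strictly on one side of a hyperplane induce a connected graph.
  If a hyperplane contains a vertex outside \<open>Y\<close> together with all of \<open>Y\<close>, then that vertex joins
  the two sides, so \<open>Y\<close> does not separate. Since a hyperplane passes through any \<open>d\<close> points, \<open>d - 1\<close>
  vertices never separate.

  A separator \<open>X\<close> of \<open>d\<close> vertices must be affinely independent and consist of all vertices on the
  hyperplane \<open>H\<close> it spans, and no edge crosses \<open>H\<close>. So \<open>P \<inter> H\<close> is the simplex on \<open>X\<close>, and for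
  \<open>d \<ge> 3\<close> every two vertices of \<open>X\<close> lie in a common facet of \<open>P\<close>. Finally, each \<open>x \<in> X\<close> has
  neighbours on both sides of \<open>H\<close>; these lie in the link of \<open>x\<close>, whose graph is a subgraph of
  \<open>G(P) - x\<close>, and are separated there by \<open>X - {x}\<close>.\<close>

section \<open>Vertices, faces and hyperplane slices of polytopes\<close>

lemma polytope_eq_convex_hull_poly_verts:
  assumes "polytope P"
  shows "P = convex hull (poly_verts P)"
  using Krein_Milman_Minkowski[OF polytope_imp_compact[OF assms] polytope_imp_convex[OF assms]]
  by (simp add: poly_verts_def face_of_singleton)

lemma finite_poly_verts: "polytope P \<Longrightarrow> finite (poly_verts P)"
  unfolding poly_verts_def face_of_singleton
  by (rule finite_polyhedron_extreme_points[OF polytope_imp_polyhedron])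

lemma poly_verts_subset: "poly_verts P \<subseteq> P"
  unfolding poly_verts_def by (auto dest: face_of_imp_subset)

lemma poly_adj_sym: "poly_adj P u v \<Longrightarrow> poly_adj P v u"
  by (auto simp: poly_adj_def insert_commute)

lemma poly_verts_face: "F face_of P \<Longrightarrow> poly_verts F = poly_verts P \<inter> F"
  by (auto simp: poly_verts_def face_of_face)

lemma poly_adj_face: "F face_of P \<Longrightarrow> poly_adj F u v \<Longrightarrow> poly_adj P u v"
  by (auto simp: poly_adj_def edge_of_def poly_verts_face intro: face_of_trans)

lemma polytope_max_attained_at_vertex:
  fixes P :: "'a::euclidean_space set"
  assumes "polytope P" "P \<noteq> {}"
  obtains v where "v \<in> poly_verts P" "\<And>x. x \<in> P \<Longrightarrow> a \<bullet> x \<le> a \<bullet> v"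
proof -
  have ne: "poly_verts P \<noteq> {}"
    using polytope_eq_convex_hull_poly_verts[OF assms(1)] assms(2) by auto
  define m where "m = Max ((\<lambda>v. a \<bullet> v) ` poly_verts P)"
  have fin: "finite ((\<lambda>v. a \<bullet> v) ` poly_verts P)"
    using finite_poly_verts[OF assms(1)] by simp
  have "m \<in> (\<lambda>v. a \<bullet> v) ` poly_verts P"
    unfolding m_def using fin ne by (intro Max_in) auto
  then obtain v where v: "v \<in> poly_verts P" "a \<bullet> v = m" by auto
  have "poly_verts P \<subseteq> {x. a \<bullet> x \<le> m}"
    unfolding m_def using fin by auto
  then have "convex hull (poly_verts P) \<subseteq> {x. a \<bullet> x \<le> m}"
    by (intro hull_minimal) (auto simp: convex_halfspace_le)
  then have "P \<subseteq> {x. a \<bullet> x \<le> m}"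
    using polytope_eq_convex_hull_poly_verts[OF assms(1)] by simp
  then show thesis using that[of v] v by auto
qed

text \<open>Take a face of least dimension containing \<open>q\<close>: if \<open>q\<close> were on
  its relative boundary, a facet of that face would contain \<open>q\<close> and have smaller
  dimension.\<close>

lemma polytope_point_in_rel_interior_of_face:
  fixes P :: "'a::euclidean_space set"
  assumes P: "polytope P" and "q \<in> P"
  obtains F where "F face_of P" "q \<in> rel_interior F"
proof -
  let ?A = "{F. F face_of P \<and> q \<in> F}"
  have "finite ?A" using finite_polytope_faces[OF P] by (rule finite_subset[rotated]) auto
  moreover have "P \<in> ?A" using assms by (simp add: face_of_refl polytope_imp_convex)
  ultimately obtain F where F: "F \<in> ?A" and min: "\<And>G. G \<in> ?A \<Longrightarrow> aff_dim F \<le> aff_dim G"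
    using ex_min_if_finite[of "aff_dim ` ?A"] by (auto simp: not_less)
  have poly: "polyhedron F"
    using F P face_of_polytope_polytope polytope_imp_polyhedron by blast
  have "q \<in> rel_interior F"
  proof (rule ccontr)
    assume "q \<notin> rel_interior F"
    then obtain G where G: "G facet_of F" "q \<in> G"
      using F rel_boundary_of_polyhedron[OF poly] by blast
    then have "G face_of P"
      using F face_of_trans facet_of_imp_face_of by blast
    then show False using min[of G] G by (auto simp: facet_of_def)
  qed
  then show thesis using that F by blast
qed

text \<open>The face \<open>F\<close> with \<open>q\<close> in its relative interior has dimension
  at most 1, since otherwise the slice would contain a segment around \<open>q\<close>. So
  \<open>q\<close> is a vertex or an inner point of an edge, and that edge must cross the
  hyperplane.\<close>

lemma extreme_point_of_hyperplane_slice: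
  fixes P :: "'a::euclidean_space set"
  assumes P: "polytope P" and q: "q extreme_point_of (P \<inter> {x. g \<bullet> x = b})"
  shows "q \<in> poly_verts P \<or>
    (\<exists>s t. poly_adj P s t \<and> g \<bullet> s < b \<and> b < g \<bullet> t \<and> q \<in> open_segment s t)"
proof -
  have qP: "q \<in> P" "g \<bullet> q = b" using q by (auto simp: extreme_point_of_def)
  obtain F where F: "F face_of P" "q \<in> rel_interior F"
    using polytope_point_in_rel_interior_of_face[OF P qP(1)] .
  then have FP: "F \<subseteq> P" and qF: "q \<in> F"
    using face_of_imp_subset rel_interior_subset by blast+
  have dim: "aff_dim F \<le> 1"
  proof (rule ccontr)
    assume "\<not> aff_dim F \<le> 1"
    then have d2: "aff_dim (affine hull F) \<ge> 2" by simp
    let ?A = "affine hull F \<inter> {x. g \<bullet> x = b}"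
    have "q \<in> ?A" using qF qP hull_inc[of q F affine] by simp
    \<comment> \<open>Cutting an affine set by a hyperplane that meets it lowers the dimension by at
      most one, so the cut contains a second point \<open>r\<close>.\<close>
    then have "?A \<noteq> {}" by blast
    then have "aff_dim ?A \<ge> 1"
      using d2 unfolding aff_dim_affine_Int_hyperplane[OF affine_affine_hull] by simp
    then have "\<not> (?A \<subseteq> {q})"
      using aff_dim_subset[of ?A "{q}"] by auto
    then obtain r where r: "r \<in> affine hull F" "g \<bullet> r = b" "r \<noteq> q" by blast
    obtain e where e: "e > 0" "cball q e \<inter> affine hull F \<subseteq> F"
      using F(2) by (auto simp: mem_rel_interior_cball)
    \<comment> \<open>Moving from \<open>q\<close> by distance \<open>e\<close> along
      \<open>r - q\<close>, in either direction, stays in \<open>F\<close> and in the hyperplane. So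
      \<open>q\<close> is the midpoint of a segment in the slice.\<close>
    define k where "k = e / norm (r - q)"
    have k: "k > 0" "k * norm (r - q) = e" using e r by (auto simp: k_def)
    have aff: "q + c *\<^sub>R (r - q) \<in> affine hull F" for c
    proof -
      have "(1 - c) *\<^sub>R q + c *\<^sub>R r \<in> affine hull F"
        using r(1) hull_inc[OF qF] by (intro mem_affine[OF affine_affine_hull]) auto
      then show ?thesis by (simp add: algebra_simps)
    qed
    have mem: "q + c *\<^sub>R (r - q) \<in> P \<inter> {x. g \<bullet> x = b}" if "\<bar>c\<bar> = k" for c
    proof -
      have "q + c *\<^sub>R (r - q) \<in> cball q e"
        using k that by (simp add: dist_norm)
      then have "q + c *\<^sub>R (r - q) \<in> P" using e(2) aff FP by blast
      then show ?thesis using r(2) qP(2) by (simp add: inner_add_right inner_diff_right)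
    qed
    have "q \<in> open_segment (q + k *\<^sub>R (r - q)) (q + (- k) *\<^sub>R (r - q))"
      unfolding in_segment
    proof (intro conjI exI[of _ "1/2"])
      show "q + k *\<^sub>R (r - q) \<noteq> q + (- k) *\<^sub>R (r - q)"
      proof
        assume "q + k *\<^sub>R (r - q) = q + (- k) *\<^sub>R (r - q)"
        then have "k *\<^sub>R (r - q) = (- k) *\<^sub>R (r - q)" by (rule add_left_imp_eq)
        then have "k = - k" using r(3) unfolding scaleR_cancel_right by simp
        then show False using k(1) by simp
      qed
      show "q = (1 - 1/2) *\<^sub>R (q + k *\<^sub>R (r - q)) + (1/2) *\<^sub>R (q + (- k) *\<^sub>R (r - q))"
        using scaleR_half_double[of q] by (simp add: scaleR_add_right scaleR_diff_right)
    qed auto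
    then show False
      using q mem[of k] mem[of "-k"] k(1) unfolding extreme_point_of_def by auto
  qed
  have "polytope F" using P F(1) face_of_polytope_polytope by blast
  then obtain s t where st: "F = closed_segment s t"
    using compact_convex_collinear_segment[of F] qF dim
    by (metis collinear_aff_dim empty_iff polytope_imp_compact polytope_imp_convex)
  have sv: "s \<in> poly_verts P" "t \<in> poly_verts P"
    using F(1) st by (auto simp: poly_verts_def face_of_singleton extreme_point_of_segment
        dest: extreme_point_of_face)
  show ?thesis
  proof (cases "s = t")
    case True
    then show ?thesis using st qF sv by auto
  next
    case False
    then have adj: "poly_adj P s t"
      using F(1) sv aff_dim_convex_hull[of "{s, t}"]
      by (simp add: poly_adj_def edge_of_def st segment_convex_hull aff_dim_2 del: aff_dim_convex_hull)
    have qs: "q \<in> open_segment s t"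
      using F(2) st False by (simp add: rel_interior_closed_segment)
    then obtain u where u: "0 < u" "u < 1" "q = (1 - u) *\<^sub>R s + u *\<^sub>R t"
      by (auto simp: in_segment)
    have gq: "b = (1 - u) * (g \<bullet> s) + u * (g \<bullet> t)"
      using qP(2) u(3) by (simp add: inner_add_right)
    \<comment> \<open>Both weights are positive, so the deviations from \<open>b\<close> at the two
      ends have opposite signs or both vanish; if both vanish, the whole edge lies in the slice and
      \<open>q\<close> is not extreme.\<close>
    have eq: "(1 - u) * (g \<bullet> s - b) = - (u * (g \<bullet> t - b))"
      using gq by (simp add: algebra_simps)
    have ne: "g \<bullet> s \<noteq> b"
    proof
      assume "g \<bullet> s = b"
      then have "g \<bullet> t = b" using eq u by simp
      then show False
        using q qs sv poly_verts_subset[of P] \<open>g \<bullet> s = b\<close> unfolding extreme_point_of_def by blast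
    qed
    consider "g \<bullet> s < b" | "g \<bullet> s > b" using ne by linarith
    then show ?thesis
    proof cases
      case 1
      then have "(1 - u) * (g \<bullet> s - b) < 0" using u by (simp add: mult_pos_neg)
      then have "g \<bullet> t > b" using eq u by (simp add: zero_less_mult_iff)
      then show ?thesis using 1 adj qs by blast
    next
      case 2
      then have "(1 - u) * (g \<bullet> s - b) > 0" using u by simp
      then have "g \<bullet> t < b" using eq u by (simp add: mult_less_0_iff)
      then show ?thesis using 2 poly_adj_sym[OF adj] qs by (metis open_segment_commute)
    qed
  qed
qed

section \<open>Exposed vertices and improving edges\<close>

lemma poly_vert_exposed:
  fixes P :: "'a::euclidean_space set"
  assumes P: "polytope P" and v: "v \<in> poly_verts P"
  obtains g where "\<And>w. w \<in> P \<Longrightarrow> w \<noteq> v \<Longrightarrow> g \<bullet> w < g \<bullet> v"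
proof -
  have "{v} exposed_face_of P"
    using v exposed_face_of_polyhedron[OF polytope_imp_polyhedron[OF P]]
    by (simp add: poly_verts_def)
  then obtain a b where ab: "P \<subseteq> {x. a \<bullet> x \<le> b}" "{v} = P \<inter> {x. a \<bullet> x = b}"
    by (auto simp: exposed_face_of_def)
  have "a \<bullet> w < a \<bullet> v" if "w \<in> P" "w \<noteq> v" for w
  proof -
    have "a \<bullet> v = b" "a \<bullet> w \<le> b" "a \<bullet> w \<noteq> b" using ab that by blast+
    then show ?thesis by simp
  qed
  then show thesis using that by blast
qed

text \<open>A hyperplane cutting off \<open>v\<close> from the other vertices meets \<open>P\<close> in the vertex figure, whose
  vertices are the intersections with the edges at \<open>v\<close>; a maximizer of \<open>a\<close> there gives the edge.\<close>

lemma poly_vert_improving_edge: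
  fixes P :: "'a::euclidean_space set"
  assumes P: "polytope P" and v: "v \<in> poly_verts P" and "\<exists>w\<in>P. a \<bullet> v < a \<bullet> w"
  shows "\<exists>u. poly_adj P v u \<and> a \<bullet> v < a \<bullet> u"
proof -
  obtain w where w: "w \<in> poly_verts P" "a \<bullet> v < a \<bullet> w"
    using polytope_max_attained_at_vertex[OF P, of a] assms(3)
    by (metis empty_iff order_less_le_trans)
  obtain g where g: "\<And>x. x \<in> P \<Longrightarrow> x \<noteq> v \<Longrightarrow> g \<bullet> x < g \<bullet> v"
    using poly_vert_exposed[OF P v] by blast
  have fin: "finite (poly_verts P - {v})" and ne: "poly_verts P - {v} \<noteq> {}"
    using finite_poly_verts[OF P] w by auto
  define m where "m = Max ((\<lambda>x. g \<bullet> x) ` (poly_verts P - {v}))"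
  have "m \<in> (\<lambda>x. g \<bullet> x) ` (poly_verts P - {v})"
    unfolding m_def using fin ne by (intro Max_in) auto
  then have mv: "m < g \<bullet> v" using g poly_verts_subset by blast
  define b where "b = (m + g \<bullet> v) / 2"
  have b: "m < b" "b < g \<bullet> v" using mv by (auto simp: b_def)
  have low: "g \<bullet> x < b" if "x \<in> poly_verts P" "x \<noteq> v" for x
  proof -
    have "g \<bullet> x \<le> m" unfolding m_def using that fin by (intro Max_ge) auto
    then show ?thesis using b(1) by simp
  qed
  define Q where "Q = P \<inter> {x. g \<bullet> x = b}"
  have Q: "polytope Q"
    unfolding Q_def by (intro polytope_Int_polyhedron P polyhedron_hyperplane)
  \<comment> \<open>The parameter at which the segment from \<open>v\<close> to \<open>w\<close>
    crosses the cutting hyperplane; the crossing point \<open>p\<close> already improves on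
    \<open>v\<close>.\<close>
  define c where "c = (g \<bullet> v - b) / (g \<bullet> v - g \<bullet> w)"
  have "w \<noteq> v" using w by auto
  then have gw: "g \<bullet> w < b" using low w by blast
  then have c: "0 < c" "c < 1" using b by (auto simp: c_def)
  have ceq: "c * (g \<bullet> v - g \<bullet> w) = g \<bullet> v - b" using gw b by (simp add: c_def)
  define p where "p = (1 - c) *\<^sub>R v + c *\<^sub>R w"
  have "p \<in> P"
    unfolding p_def using c v w(1) poly_verts_subset[of P]
    by (intro convexD[OF polytope_imp_convex[OF P]]) auto
  moreover have "g \<bullet> p = b" using ceq by (simp add: p_def inner_add_right algebra_simps)
  ultimately have "p \<in> Q" by (simp add: Q_def)
  have "a \<bullet> p = a \<bullet> v + c * (a \<bullet> w - a \<bullet> v)"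
    by (simp add: p_def inner_add_right algebra_simps)
  then have ap: "a \<bullet> v < a \<bullet> p" using c w by simp
  obtain q where q: "q \<in> poly_verts Q" "a \<bullet> p \<le> a \<bullet> q"
    using polytope_max_attained_at_vertex[OF Q, of a] \<open>p \<in> Q\<close> by (metis empty_iff)
  have qe: "q extreme_point_of Q" using q by (simp add: poly_verts_def face_of_singleton)
  have "q \<notin> poly_verts P"
  proof
    assume "q \<in> poly_verts P"
    moreover have "g \<bullet> q = b" using qe by (simp add: Q_def extreme_point_of_def)
    ultimately show False using low[of q] b by (cases "q = v") auto
  qed
  then obtain s t where st: "poly_adj P s t" "g \<bullet> s < b" "b < g \<bullet> t" "q \<in> open_segment s t"
    using extreme_point_of_hyperplane_slice[OF P qe[unfolded Q_def]] by blast
  \<comment> \<open>The only vertex above the level \<open>b\<close> is \<open>v\<close>, so every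
    crossing edge starts there.\<close>
  then have "t = v" using low[of t] by (auto simp: poly_adj_def)
  obtain r where r: "0 < r" "r < 1" "q = (1 - r) *\<^sub>R s + r *\<^sub>R t"
    using st(4) by (auto simp: in_segment)
  \<comment> \<open>The right side is the value of \<open>a\<close> at \<open>q\<close>, which is at
    least that at \<open>p\<close>. A proper convex combination of \<open>s\<close> and
    \<open>v\<close> exceeds \<open>v\<close> only if \<open>s\<close> does.\<close>
  have "a \<bullet> v < (1 - r) * (a \<bullet> s) + r * (a \<bullet> v)"
    using ap q(2) r(3) \<open>t = v\<close> by (simp add: inner_add_right)
  then have "(1 - r) * (a \<bullet> v) < (1 - r) * (a \<bullet> s)" by (simp add: algebra_simps)
  then have "a \<bullet> v < a \<bullet> s" using r by simp
  then show ?thesis using poly_adj_sym[OF st(1)] \<open>t = v\<close> by blast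
qed

section \<open>Reachability in induced subgraphs\<close>

lemma reach_in_trans: "reach_in S E u v \<Longrightarrow> reach_in S E v w \<Longrightarrow> reach_in S E u w"
  by (auto simp: reach_in_def)

lemma reach_in_step: "u \<in> S \<Longrightarrow> v \<in> S \<Longrightarrow> E u v \<Longrightarrow> reach_in S E u v"
  by (auto simp: reach_in_def)

lemma reach_in_mono:
  assumes "reach_in S E u v" "S \<subseteq> T" "\<And>a b. a \<in> S \<Longrightarrow> b \<in> S \<Longrightarrow> E a b \<Longrightarrow> E' a b"
  shows "reach_in T E' u v"
  using assms unfolding reach_in_def
  by (auto elim!: rtranclp_mono[THEN predicate2D, rotated])

lemma reach_in_sym:
  assumes "reach_in S E u v" "\<And>a b. E a b \<Longrightarrow> E b a"
  shows "reach_in S E v u"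
proof -
  have "symp (\<lambda>a b. a \<in> S \<and> b \<in> S \<and> E a b)" using assms(2) by (auto simp: symp_def)
  then have "symp (\<lambda>a b. a \<in> S \<and> b \<in> S \<and> E a b)\<^sup>*\<^sup>*" by (rule symp_rtranclp)
  then show ?thesis using assms(1) by (auto simp: reach_in_def dest: sympD)
qed

lemma graph_connected_hub:
  assumes "\<And>v. v \<in> S \<Longrightarrow> reach_in S E v h" "\<And>a b. E a b \<Longrightarrow> E b a"
  shows "graph_connected S E"
  unfolding graph_connected_def
  by (meson assms reach_in_sym reach_in_trans)

section \<open>Monotone paths and connectivity of halfspace subgraphs\<close>

text \<open>Follow improving edges as in the simplex method. Each one reduces the number of strictly
  better vertices, and the path never drops below the starting value.\<close>

lemma reach_in_maximizer:
  fixes P :: "'a::euclidean_space set"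
  assumes P: "polytope P" and "v \<in> poly_verts P"
  shows "\<exists>t\<in>poly_verts P. (\<forall>x\<in>P. a \<bullet> x \<le> a \<bullet> t) \<and>
    reach_in {w \<in> poly_verts P. a \<bullet> v \<le> a \<bullet> w} (poly_adj P) v t"
  using assms(2)
proof (induction "card {w \<in> poly_verts P. a \<bullet> v < a \<bullet> w}" arbitrary: v rule: less_induct)
  case less
  show ?case
  proof (cases "\<exists>w\<in>P. a \<bullet> v < a \<bullet> w")
    case False
    then show ?thesis using less.prems by (intro bexI[of _ v]) (auto simp: reach_in_def not_less)
  next
    case True
    then obtain u where u: "poly_adj P v u" "a \<bullet> v < a \<bullet> u"
      using poly_vert_improving_edge[OF P less.prems] by blast
    then have uV: "u \<in> poly_verts P" by (simp add: poly_adj_def)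
    have "card {w \<in> poly_verts P. a \<bullet> u < a \<bullet> w} < card {w \<in> poly_verts P. a \<bullet> v < a \<bullet> w}"
      using u(2) uV finite_poly_verts[OF P] by (intro psubset_card_mono) auto
    then obtain t where t: "t \<in> poly_verts P" "\<forall>x\<in>P. a \<bullet> x \<le> a \<bullet> t"
      "reach_in {w \<in> poly_verts P. a \<bullet> u \<le> a \<bullet> w} (poly_adj P) u t"
      using less.hyps uV by blast
    have ut: "reach_in {w \<in> poly_verts P. a \<bullet> v \<le> a \<bullet> w} (poly_adj P) u t"
      using u(2) by (intro reach_in_mono[OF t(3)]) auto
    have "reach_in {w \<in> poly_verts P. a \<bullet> v \<le> a \<bullet> w} (poly_adj P) v u"
      using u uV less.prems by (intro reach_in_step) auto
    from reach_in_trans[OF this ut] show ?thesis using t(1,2) by blast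
  qed
qed

text \<open>For a functional exposing the vertex \<open>h\<close>, the only maximizer is
  \<open>h\<close>, so every ascending path ends there.\<close>

lemma graph_connected_polytope:
  fixes P :: "'a::euclidean_space set"
  assumes P: "polytope P"
  shows "graph_connected (poly_verts P) (poly_adj P)"
proof (cases "poly_verts P = {}")
  case True
  then show ?thesis by (simp add: graph_connected_def)
next
  case False
  then obtain h where h: "h \<in> poly_verts P" by blast
  obtain g where g: "\<And>x. x \<in> P \<Longrightarrow> x \<noteq> h \<Longrightarrow> g \<bullet> x < g \<bullet> h"
    using poly_vert_exposed[OF P h] by blast
  show ?thesis
  proof (rule graph_connected_hub)
    fix v assume "v \<in> poly_verts P"
    then obtain t where t: "t \<in> poly_verts P" "\<forall>x\<in>P. g \<bullet> x \<le> g \<bullet> t"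
      "reach_in {w \<in> poly_verts P. g \<bullet> v \<le> g \<bullet> w} (poly_adj P) v t"
      using reach_in_maximizer[OF P] by blast
    have "t = h" using t g h poly_verts_subset[of P] by (metis not_less subsetD)
    then show "reach_in (poly_verts P) (poly_adj P) v h"
      using reach_in_mono[OF t(3)] by blast
  qed (rule poly_adj_sym)
qed

text \<open>Ascending paths stay in the halfspace and end in the face of maximizers. That face is
  itself a polytope with connected graph, and its vertices lie in the halfspace as well.\<close>

lemma graph_connected_open_halfspace:
  fixes P :: "'a::euclidean_space set"
  assumes P: "polytope P"
  shows "graph_connected {v \<in> poly_verts P. c < a \<bullet> v} (poly_adj P)"
  unfolding graph_connected_def
proof (intro ballI)
  fix u v
  let ?S = "{v \<in> poly_verts P. c < a \<bullet> v}"
  assume uv: "u \<in> ?S" "v \<in> ?S"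
  have max: "\<exists>t\<in>poly_verts P. (\<forall>x\<in>P. a \<bullet> x \<le> a \<bullet> t) \<and> reach_in ?S (poly_adj P) w t"
    if w: "w \<in> ?S" for w
  proof -
    obtain t where t: "t \<in> poly_verts P" "\<forall>x\<in>P. a \<bullet> x \<le> a \<bullet> t"
      "reach_in {x \<in> poly_verts P. a \<bullet> w \<le> a \<bullet> x} (poly_adj P) w t"
      using reach_in_maximizer[OF P] w by blast
    have "reach_in ?S (poly_adj P) w t"
      using w by (intro reach_in_mono[OF t(3)]) auto
    then show ?thesis using t by blast
  qed
  obtain s where s: "s \<in> poly_verts P" "\<forall>x\<in>P. a \<bullet> x \<le> a \<bullet> s" "reach_in ?S (poly_adj P) u s"
    using max[OF uv(1)] by blast
  obtain t where t: "t \<in> poly_verts P" "\<forall>x\<in>P. a \<bullet> x \<le> a \<bullet> t" "reach_in ?S (poly_adj P) v t"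
    using max[OF uv(2)] by blast
  have eq: "a \<bullet> s = a \<bullet> t" using s t poly_verts_subset[of P] by (meson antisym subsetD)
  define T where "T = P \<inter> {x. a \<bullet> x = a \<bullet> s}"
  have T: "T face_of P"
    unfolding T_def using s(2) polytope_imp_convex[OF P]
    by (intro face_of_Int_supporting_hyperplane_le) auto
  have sub: "poly_verts T \<subseteq> ?S"
    using s(3) unfolding poly_verts_face[OF T] by (auto simp: T_def reach_in_def)
  have "reach_in (poly_verts T) (poly_adj T) s t"
    using graph_connected_polytope[OF face_of_polytope_polytope[OF P T]] s t eq
      poly_verts_subset[of P]
    unfolding graph_connected_def poly_verts_face[OF T] by (auto simp: T_def)
  then have "reach_in ?S (poly_adj P) s t"
    using sub poly_adj_face[OF T] by (rule reach_in_mono)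
  then show "reach_in ?S (poly_adj P) u v"
    using s(3) reach_in_sym[OF t(3) poly_adj_sym] by (blast intro: reach_in_trans)
qed

section \<open>Separators contained in a hyperplane, and d-connectivity\<close>

text \<open>A remaining vertex on or above the hyperplane reaches every vertex strictly above it,
  and symmetrically below. If one open side had no vertices, or a path joined the two sides, some
  vertex would be reachable from all others. A remaining vertex on the hyperplane would itself join
  the sides.\<close>

lemma separator_in_hyperplane:
  fixes P :: "'a::euclidean_space set"
  assumes P: "polytope P" and Y: "Y \<subseteq> {x. a \<bullet> x = c}" and nP: "\<not> P \<subseteq> {x. a \<bullet> x = c}"
    and Ysub: "Y \<subseteq> poly_verts P"
    and disc: "\<not> graph_connected (poly_verts P - Y) (poly_adj P)"
  shows "Y = poly_verts P \<inter> {x. a \<bullet> x = c}"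
    and "\<exists>u\<in>poly_verts P. c < a \<bullet> u"
    and "\<exists>w\<in>poly_verts P. a \<bullet> w < c"
    and "\<And>u w. u \<in> poly_verts P \<Longrightarrow> w \<in> poly_verts P \<Longrightarrow> c < a \<bullet> u \<Longrightarrow> a \<bullet> w < c \<Longrightarrow>
      \<not> reach_in (poly_verts P - Y) (poly_adj P) u w"
proof -
  let ?V = "poly_verts P" and ?S = "poly_verts P - Y" and ?E = "poly_adj P"
  \<comment> \<open>Stated for an arbitrary functional so that negating \<open>a\<close> and
    \<open>c\<close> gives the lower side.\<close>
  have side: "reach_in ?S ?E w u"
    if u: "u \<in> ?V" "k < b \<bullet> u" and w: "w \<in> ?S" "k \<le> b \<bullet> w" and Yk: "Y \<subseteq> {x. b \<bullet> x = k}"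
    for b k u w
  proof -
    let ?U = "{v \<in> ?V. k < b \<bullet> v}"
    have *: "reach_in ?S ?E z u" if "z \<in> ?U" for z
    proof (rule reach_in_mono)
      show "reach_in ?U ?E z u"
        using graph_connected_open_halfspace[OF P] that u unfolding graph_connected_def by blast
    qed (use Yk in auto)
    show ?thesis
    proof (cases "k < b \<bullet> w")
      case True
      then show ?thesis using * w by blast
    next
      case False
      then have "b \<bullet> w < b \<bullet> u" using u by simp
      \<comment> \<open>Here \<open>w\<close> lies on the hyperplane; one improving edge enters the
        open halfspace, which avoids \<open>Y\<close>.\<close>
      then obtain z where z: "?E w z" "b \<bullet> w < b \<bullet> z"
        using poly_vert_improving_edge[OF P, of w b] u w poly_verts_subset[of P] by blast
      then have "z \<in> ?U" using w by (auto simp: poly_adj_def)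
      then have "reach_in ?S ?E w z"
        using z w Yk by (intro reach_in_step) auto
      then show ?thesis using * \<open>z \<in> ?U\<close> by (blast intro: reach_in_trans)
    qed
  qed
  have up: "reach_in ?S ?E w u" if "u \<in> ?V" "c < a \<bullet> u" "w \<in> ?S" "c \<le> a \<bullet> w" for u w
    using side[OF that Y] .
  have dn: "reach_in ?S ?E w u" if "u \<in> ?V" "a \<bullet> u < c" "w \<in> ?S" "a \<bullet> w \<le> c" for u w
    using side[of u "- c" "- a" w] that Y by auto
  have "\<exists>v\<in>?V. a \<bullet> v \<noteq> c"
  proof (rule ccontr)
    assume "\<not> ?thesis"
    then have "convex hull ?V \<subseteq> {x. a \<bullet> x = c}"
      by (intro hull_minimal) (auto simp: convex_hyperplane)
    then show False using nP polytope_eq_convex_hull_poly_verts[OF P] by simp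
  qed
  then have some: "(\<exists>u\<in>?V. c < a \<bullet> u) \<or> (\<exists>w\<in>?V. a \<bullet> w < c)" by (meson linorder_neq_iff)
  show ex_up: "\<exists>u\<in>?V. c < a \<bullet> u"
  proof (rule ccontr)
    assume none: "\<not> ?thesis"
    then obtain h where h: "h \<in> ?V" "a \<bullet> h < c" using some by blast
    have "graph_connected ?S ?E"
    proof (rule graph_connected_hub)
      show "reach_in ?S ?E v h" if "v \<in> ?S" for v
        using none dn[OF h that] that by (auto simp: not_less)
    qed (rule poly_adj_sym)
    then show False using disc by blast
  qed
  show ex_dn: "\<exists>w\<in>?V. a \<bullet> w < c"
  proof (rule ccontr)
    assume none: "\<not> ?thesis"
    then obtain h where h: "h \<in> ?V" "c < a \<bullet> h" using some by blast
    have "graph_connected ?S ?E"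
    proof (rule graph_connected_hub)
      show "reach_in ?S ?E v h" if "v \<in> ?S" for v
        using none up[OF h that] that by (auto simp: not_less)
    qed (rule poly_adj_sym)
    then show False using disc by blast
  qed
  show sep: "\<not> reach_in ?S ?E u w"
    if uw: "u \<in> ?V" "w \<in> ?V" "c < a \<bullet> u" "a \<bullet> w < c" for u w
  proof
    assume r: "reach_in ?S ?E u w"
    have "graph_connected ?S ?E"
    proof (rule graph_connected_hub)
      show "reach_in ?S ?E v w" if v: "v \<in> ?S" for v
      proof (cases "c \<le> a \<bullet> v")
        case True
        from reach_in_trans[OF up[OF uw(1,3) v this] r] show ?thesis .
      next
        case False
        then show ?thesis using dn[OF uw(2,4) v] by simp
      qed
    qed (rule poly_adj_sym)
    then show False using disc by blast
  qed
  show "Y = ?V \<inter> {x. a \<bullet> x = c}"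
  proof (rule ccontr)
    assume "\<not> ?thesis"
    then obtain z where z: "z \<in> ?S" "a \<bullet> z = c" using Y Ysub by blast
    obtain u w where uw: "u \<in> ?V" "c < a \<bullet> u" "w \<in> ?V" "a \<bullet> w < c" using ex_up ex_dn by blast
    have zu: "reach_in ?S ?E z u" and zw: "reach_in ?S ?E z w"
      using up[OF uw(1,2) z(1)] dn[OF uw(3,4) z(1)] z(2) by auto
    have "reach_in ?S ?E u w"
      using reach_in_trans[OF reach_in_sym[OF zu poly_adj_sym] zw] .
    then show False using sep uw by blast
  qed
qed

lemma full_dim_not_subset_hyperplane:
  fixes P :: "'a::euclidean_space set"
  assumes "aff_dim P = int DIM('a)" "a \<noteq> 0"
  shows "\<not> P \<subseteq> {x. a \<bullet> x = c}"
  using assms aff_dim_subset[of P "{x. a \<bullet> x = c}"] by (auto simp: aff_dim_hyperplane)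

text \<open>If the dimension were smaller, some hyperplane would contain \<open>Y\<close> and one
  more vertex \<open>w\<close>, although a disconnecting \<open>Y\<close> contains every vertex on
  such a hyperplane.\<close>

lemma aff_dim_separator:
  fixes P :: "'a::euclidean_space set"
  assumes P: "polytope P" and dim: "aff_dim P = int DIM('a)" and Y: "Y \<subseteq> poly_verts P"
    and disc: "\<not> graph_connected (poly_verts P - Y) (poly_adj P)"
  shows "int DIM('a) - 1 \<le> aff_dim Y"
proof (rule ccontr)
  assume *: "\<not> ?thesis"
  obtain w where w: "w \<in> poly_verts P" "w \<notin> Y"
    using disc by (auto simp: graph_connected_def)
  have "aff_dim (insert w Y) < int DIM('a)" using * by (simp add: aff_dim_insert)
  then obtain a c where ac: "a \<noteq> 0" "insert w Y \<subseteq> {x. a \<bullet> x = c}"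
    using aff_lowdim_subset_hyperplane by blast
  then have "Y = poly_verts P \<inter> {x. a \<bullet> x = c}"
    using full_dim_not_subset_hyperplane[OF dim ac(1)] Y
    by (intro separator_in_hyperplane(1)[OF P _ _ _ disc]) auto
  then show False using w ac by auto
qed

text \<open>Fewer than d vertices have affine dimension at most d - 2, too little to disconnect the
  graph.\<close>

theorem k_connected_polytope:
  fixes P :: "'a::euclidean_space set"
  assumes P: "polytope P" and dim: "aff_dim P = int DIM('a)"
  shows "k_connected DIM('a) (poly_verts P) (poly_adj P)"
  unfolding k_connected_def
proof (intro conjI allI impI)
  show fin: "finite (poly_verts P)" using finite_poly_verts[OF P] .
  have "aff_dim (poly_verts P) = int DIM('a)"
    using polytope_eq_convex_hull_poly_verts[OF P] dim by (metis aff_dim_convex_hull)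
  then show "DIM('a) + 1 \<le> card (poly_verts P)"
    using aff_dim_le_card[OF fin] by linarith
  fix Y assume Y: "Y \<subseteq> poly_verts P \<and> card Y < DIM('a)"
  then have "aff_dim Y \<le> int (card Y) - 1"
    using aff_dim_le_card fin finite_subset by blast
  then show "graph_connected (poly_verts P - Y) (poly_adj P)"
    using aff_dim_separator[OF P dim, of Y] Y by linarith
qed

section \<open>Separators with d vertices, and links\<close>

text \<open>It suffices that the midpoint of \<open>x\<close> and \<open>y\<close> is on the
  boundary of \<open>P\<close>: a facet containing it contains both ends. An interior midpoint would
  be an inner point of a segment in the simplex on \<open>X\<close> ending at a third vertex
  \<open>z\<close>, although \<open>x\<close> and \<open>y\<close> span a face without
  \<open>z\<close>.\<close>

lemma separator_pair_in_facet:
  fixes P :: "'a::euclidean_space set"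
  assumes P: "polytope P" and dim: "aff_dim P = int DIM('a)" and d3: "DIM('a) \<ge> 3"
    and X: "X \<subseteq> poly_verts P" "finite X" "card X = DIM('a)"
    and disc: "\<not> graph_connected (poly_verts P - X) (poly_adj P)"
    and xy: "x \<in> X" "y \<in> X" "x \<noteq> y"
  shows "\<exists>G. G facet_of P \<and> x \<in> G \<and> y \<in> G"
proof -
  have adX: "aff_dim X = int (card X) - 1"
    using aff_dim_separator[OF P dim X(1) disc] aff_dim_le_card[OF X(2)] X(3) by linarith
  then have indep: "\<not> affine_dependent X"
    using X(2) affine_independent_iff_card by blast
  have "aff_dim X < int DIM('a)" using adX X(3) by simp
  then obtain a c where ac: "a \<noteq> 0" "X \<subseteq> {x. a \<bullet> x = c}"
    using aff_lowdim_subset_hyperplane by blast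
  note sep = separator_in_hyperplane[OF P ac(2) full_dim_not_subset_hyperplane[OF dim ac(1)] X(1) disc]
  define Q where "Q = P \<inter> {x. a \<bullet> x = c}"
  have Q: "polytope Q"
    unfolding Q_def by (intro polytope_Int_polyhedron P polyhedron_hyperplane)
  \<comment> \<open>A vertex of the slice that is not a vertex of \<open>P\<close> would lie on an
    edge crossing the hyperplane, and that edge would connect the two sides while avoiding
    \<open>X\<close>.\<close>
  have "poly_verts Q \<subseteq> X"
  proof
    fix q assume "q \<in> poly_verts Q"
    then have qe: "q extreme_point_of (P \<inter> {x. a \<bullet> x = c})"
      by (simp add: poly_verts_def face_of_singleton Q_def)
    have no: False if st: "poly_adj P s t" "a \<bullet> s < c" "c < a \<bullet> t" for s t
    proof -
      have V: "s \<in> poly_verts P" "t \<in> poly_verts P" using st by (auto simp: poly_adj_def)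
      then have "reach_in (poly_verts P - X) (poly_adj P) t s"
        using ac(2) st(2,3) poly_adj_sym[OF st(1)] by (intro reach_in_step) auto
      then show False using sep(4)[OF V(2,1) st(3,2)] by blast
    qed
    then have "q \<in> poly_verts P"
      using extreme_point_of_hyperplane_slice[OF P qe] by blast
    moreover have "a \<bullet> q = c" using qe by (simp add: extreme_point_of_def)
    ultimately show "q \<in> X" using sep(1) by blast
  qed
  then have QX: "Q \<subseteq> convex hull X"
    using polytope_eq_convex_hull_poly_verts[OF Q] hull_mono[of "poly_verts Q" X convex] by simp
  \<comment> \<open>Here \<open>d3\<close> enters: \<open>X\<close> has at least three
    elements.\<close>
  obtain z where z: "z \<in> X" "z \<noteq> x" "z \<noteq> y"
  proof -
    have "card {x, y} < card X" using d3 X(3) xy(3) by simp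
    then have "\<not> X \<subseteq> {x, y}" by (meson card_mono finite.emptyI finite.insertI not_less)
    then show thesis using that by blast
  qed
  let ?m = "midpoint x y"
  have inP: "x \<in> P" "y \<in> P" using xy X(1) poly_verts_subset by blast+
  have am: "a \<bullet> x = c" "a \<bullet> y = c" "a \<bullet> z = c" using xy z ac(2) by auto
  have mseg: "?m \<in> open_segment x y" using xy(3) by simp
  have mP: "?m \<in> P"
    using mseg inP polytope_imp_convex[OF P] by (meson convex_contains_open_segment subsetD)
  have face: "convex hull {x, y} face_of convex hull X"
    unfolding face_of_convex_hull_affine_independent[OF indep]
    using xy by (intro exI[of _ "{x, y}"]) auto
  have zn: "z \<notin> convex hull {x, y}"
  proof
    assume "z \<in> convex hull {x, y}"
    then have "z \<in> affine hull (X - {z})"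
      using convex_hull_subset_affine_hull[of "{x,y}"] hull_mono[of "{x,y}" "X - {z}" affine] xy z
      by blast
    then show False using indep z(1) unfolding affine_dependent_def by blast
  qed
  have mhull: "?m \<in> convex hull {x, y}"
    using open_closed_segment[OF mseg] unfolding segment_convex_hull .
  have "?m \<notin> interior P"
  proof
    assume "?m \<in> interior P"
    then obtain e where e: "e > 0" "cball ?m e \<subseteq> P" by (auto simp: mem_interior_cball)
    have mz: "?m \<noteq> z" using mhull zn by auto
    define k where "k = e / norm (?m - z)"
    have k: "k > 0" "k * norm (?m - z) = e" using e mz by (auto simp: k_def)
    \<comment> \<open>The line from \<open>z\<close> through the midpoint, prolonged by
      \<open>e\<close>: it stays in \<open>P\<close> by the choice of the ball and in the hyperplane
      because \<open>z\<close> and the midpoint are there.\<close>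
    define p where "p = ?m + k *\<^sub>R (?m - z)"
    have "p \<in> P" using e(2) k by (auto simp: p_def dist_norm)
    moreover have "a \<bullet> p = c"
      using am by (simp add: p_def midpoint_def inner_add_right inner_diff_right)
    ultimately have "p \<in> convex hull X" using QX by (auto simp: Q_def)
    moreover have "z \<in> convex hull X" using z by (simp add: hull_inc)
    moreover have "?m \<in> open_segment p z"
    proof -
      have "p - z = (1 + k) *\<^sub>R (?m - z)" by (simp add: p_def algebra_simps)
      moreover from this have "p \<noteq> z" using k(1) mz by auto
      moreover have "?m = z + (1 / (1 + k)) *\<^sub>R (p - z)"
        using calculation(1) k(1) by simp
      then have "?m = (1 - 1 / (1 + k)) *\<^sub>R z + (1 / (1 + k)) *\<^sub>R p"
        by (simp add: algebra_simps)
      ultimately have "?m \<in> open_segment z p"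
        unfolding in_segment using k(1) by (intro conjI exI[of _ "1 / (1 + k)"]) auto
      then show ?thesis by (simp add: open_segment_commute)
    qed
    ultimately show False using face_ofD[OF face] mhull zn by blast
  qed
  then have "?m \<in> P - rel_interior P"
    using mP dim by (simp add: interior_rel_interior_gen)
  then obtain G where G: "G facet_of P" "?m \<in> G"
    using rel_boundary_of_polyhedron[OF polytope_imp_polyhedron[OF P]] by blast
  then have "x \<in> G \<and> y \<in> G"
    using face_ofD[OF facet_of_imp_face_of mseg inP] by blast
  then show ?thesis using G by blast
qed

text \<open>In dimension above 1 an edge is a proper face, so it lies in a facet, which then
  contains both \<open>x\<close> and \<open>u\<close>.\<close>

lemma poly_adj_imp_link_vert:
  fixes P :: "'a::euclidean_space set"
  assumes P: "polytope P" and dim: "aff_dim P > 1" and adj: "poly_adj P x u"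
  shows "u \<in> link_verts P x"
proof -
  have e: "convex hull {x, u} face_of P" "aff_dim (convex hull {x, u}) = 1"
    using adj by (auto simp: poly_adj_def edge_of_def)
  have "convex hull {x, u} \<noteq> {}" "convex hull {x, u} \<noteq> P" using e(2) dim by auto
  then obtain G where "G facet_of P" "convex hull {x, u} \<subseteq> G"
    using face_of_polyhedron_subset_facet[OF polytope_imp_polyhedron[OF P] e(1)] by blast
  moreover have "{x, u} \<subseteq> convex hull {x, u}" by (rule hull_subset)
  ultimately show ?thesis
    using adj by (auto simp: link_verts_def link_faces_def poly_adj_def poly_verts_def)
qed

lemma link_verts_subset: "link_verts P x \<subseteq> poly_verts P - {x}"
  by (auto simp: link_verts_def link_faces_def poly_verts_def)

lemma link_adj_imp_poly_adj: "link_adj P x u v \<Longrightarrow> poly_adj P u v"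
  using link_verts_subset by (fastforce simp: link_adj_def poly_adj_def)

theorem theorem3:
  fixes P :: "'a::euclidean_space set"
  assumes "polytope P" and "aff_dim P = int DIM('a)"
  shows "k_connected DIM('a) (poly_verts P) (poly_adj P)
         \<and> (DIM('a) \<ge> 3 \<longrightarrow>
             (\<forall>X. separator (poly_verts P) (poly_adj P) X \<and> finite X \<and> card X = DIM('a) \<longrightarrow>
               (\<forall>x\<in>X. X - {x} \<subseteq> link_verts P x \<and>
                       separator (link_verts P x) (link_adj P x) (X - {x}))))"
proof (intro conjI impI allI ballI)
  show "k_connected DIM('a) (poly_verts P) (poly_adj P)"
    using k_connected_polytope assms .
next
  fix X x
  assume d3: "DIM('a) \<ge> 3" and x: "x \<in> X"
    and "separator (poly_verts P) (poly_adj P) X \<and> finite X \<and> card X = DIM('a)"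
  then have X: "X \<subseteq> poly_verts P" "finite X" "card X = DIM('a)"
    and disc: "\<not> graph_connected (poly_verts P - X) (poly_adj P)"
    by (auto simp: separator_def separates_def graph_connected_def)
  show sub: "X - {x} \<subseteq> link_verts P x"
  proof
    fix y assume y: "y \<in> X - {x}"
    then obtain G where "G facet_of P" "x \<in> G" "y \<in> G"
      using separator_pair_in_facet[OF assms d3 X disc x] by blast
    then show "y \<in> link_verts P x"
      using y X(1) by (auto simp: link_verts_def link_faces_def poly_verts_def)
  qed
  have "aff_dim X \<le> int DIM('a) - 1" using aff_dim_le_card[OF X(2)] X(3) by simp
  then obtain a c where ac: "a \<noteq> 0" "X \<subseteq> {x. a \<bullet> x = c}"
    using aff_lowdim_subset_hyperplane[of X] by (metis zle_diff1_eq)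
  note sep = separator_in_hyperplane[OF assms(1) ac(2)
      full_dim_not_subset_hyperplane[OF assms(2) ac(1)] X(1) disc]
  have xV: "x \<in> poly_verts P" "a \<bullet> x = c" using x X(1) ac(2) by auto
  \<comment> \<open>Since there are vertices on both sides, \<open>x\<close> maximizes neither
    \<open>a\<close> nor \<open>- a\<close>, and improving edges give it a neighbour on each
    side.\<close>
  have "\<exists>w\<in>P. a \<bullet> x < a \<bullet> w" "\<exists>w\<in>P. (- a) \<bullet> x < (- a) \<bullet> w"
    using sep(2,3) xV(2) poly_verts_subset[of P] by auto
  then obtain u w where u: "poly_adj P x u" "c < a \<bullet> u" and w: "poly_adj P x w" "a \<bullet> w < c"
    using poly_vert_improving_edge[OF assms(1) xV(1), of a]
      poly_vert_improving_edge[OF assms(1) xV(1), of "- a"] xV(2) by auto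
  have uw: "u \<in> link_verts P x" "w \<in> link_verts P x"
    using u(1) w(1) assms d3 by (auto intro!: poly_adj_imp_link_vert)
  have "\<not> reach_in (link_verts P x - (X - {x})) (link_adj P x) u w"
  proof
    assume r: "reach_in (link_verts P x - (X - {x})) (link_adj P x) u w"
    \<comment> \<open>The link omits \<open>x\<close>, so deleting \<open>X - {x}\<close> from it
      leaves only vertices outside \<open>X\<close>, and a path in the link is a path in the graph
      of \<open>P\<close>.\<close>
    have "reach_in (poly_verts P - X) (poly_adj P) u w"
      using link_verts_subset[of P x] by (intro reach_in_mono[OF r] link_adj_imp_poly_adj) auto
    then show False
      using sep(4)[OF _ _ u(2) w(2)] uw link_verts_subset[of P x] by blast
  qed
  moreover have "u \<notin> X" "w \<notin> X" using u(2) w(2) ac(2) by auto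
  ultimately show "separator (link_verts P x) (link_adj P x) (X - {x})"
    using sub uw by (auto simp: separator_def separates_def)
qed

end
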